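(* Let $f$ be $L$-smooth, $f\in PL(\mu)$ and $g\in\mathrm{ER}(\rho)$. Let $\gamma_k=\gamma$ for all $k$ with $0<\gamma\le\frac{1}{1+2\rho/\mu}\frac1L$. Then the iterates of SGD satisfy, for all $k\ge0$, $$\mathbb{E}[f(x^k)-f^*]\le(1-\gamma\mu)^k[f(x^0)-f^*]+\frac{L\gamma\sigma^2}{\mu}.$$ Hence, given $\epsilon>0$ and using the step size $\gamma=\frac1L\min\left\{\frac{\mu\epsilon}{2\sigma^2},\frac{1}{1+2\rho/\mu}\right\}$, we have $$k\ge\frac L\mu\max\left\{\frac{2\sigma^2}{\mu\epsilon},\,1+\frac{2\rho}{\mu}\right\}\log\left(\frac{2(f(x^0)-f^* )}{\epsilon}\right)\ \Longrightarrow\ \mathbb{E}[f(x^k)-f^*]\le\epsilon.$$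
   Context: $f_1,\dots,f_n:\mathbb{R}^d\to\mathbb{R}$ are differentiable, $f=\frac1n\sum_if_i$ has a nonempty set $\mathcal{X}^*$ of global minimizers, $f^*=\min f$. A sampling vector is a random vector $v\in\mathbb{R}^n$ with nonnegative entries and $\mathbb{E}[v_i]=1$; $f_v=\frac1n\sum_iv_if_i$, $g(x)=\nabla f_v(x)$. SGD from a deterministic $x^0$: $x^{k+1}=x^k-\gamma_k\nabla f_{v^k}(x^k)$, with $v^0,v^1,\dots$ i.i.d. copies of $v$. The gradient noise $\sigma^2:=\sup_{x^*\in\mathcal{X}^*}\mathbb{E}\|g(x^* )\|^2$ is assumed finite (if $\sigma=0$, $\frac{\mu\epsilon}{2\sigma^2}$ is read as $+\infty$). $f$ is $L$-smooth ($L>0$) if $f(z)-f(x)\le\langle\nabla f(x),z-x\rangle+\frac L2\|z-x\|^2$ for all $x,z$. $f\in PL(\mu)$, $\mu>0$, means $\|\nabla f(x)\|^2\ge2\mu(f(x)-f^* )$ for all $x$. $g\in\mathrm{ER}(\rho)$, $\rho\ge0$, means that for a fixed $x^*\in\mathcal{X}^*$, $\mathbb{E}\|g(x)-g(x^* )-(\nabla f(x)-\nabla f(x^* ))\|^2\le2\rho(f(x)-f(x^* ))$ for all $x$. *)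

theory Defs
  imports "HOL-Probability.Probability"
begin

definition grad :: "('a::real_inner \<Rightarrow> real) \<Rightarrow> 'a \<Rightarrow> 'a" where
  "grad f x = (THE D. GDERIV f x :> D)"

definition minimizers :: "('a \<Rightarrow> real) \<Rightarrow> 'a set" where
  "minimizers f = {x. is_arg_min f (\<lambda>_. True) x}"

text \<open>Only meaningful when the minimum is attained; the infimum over the reals is then the minimum.\<close>
definition min_value :: "('a \<Rightarrow> real) \<Rightarrow> real" where
  "min_value f = (INF x. f x)"

definition mean_fun :: "('n::finite \<Rightarrow> 'a \<Rightarrow> real) \<Rightarrow> 'a \<Rightarrow> real" where
  "mean_fun F x = (1 / real CARD('n)) * (\<Sum>i\<in>UNIV. F i x)"

definition reweighted_fun :: "('n::finite \<Rightarrow> 'a \<Rightarrow> real) \<Rightarrow> real ^ 'n \<Rightarrow> 'a \<Rightarrow> real" where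
  "reweighted_fun F w x = (1 / real CARD('n)) * (\<Sum>i\<in>UNIV. w $ i * F i x)"

definition stoch_grad :: "('n::finite \<Rightarrow> 'a::real_inner \<Rightarrow> real) \<Rightarrow> real ^ 'n \<Rightarrow> 'a \<Rightarrow> 'a" where
  "stoch_grad F w x = grad (reweighted_fun F w) x"

definition sampling_vector :: "'b measure \<Rightarrow> ('b \<Rightarrow> real ^ 'n::finite) \<Rightarrow> bool" where
  "sampling_vector N v \<longleftrightarrow>
     prob_space N \<and> v \<in> borel_measurable N \<and>
     (\<forall>i. AE \<omega> in N. 0 \<le> v \<omega> $ i) \<and>
     (\<forall>i. integrable N (\<lambda>\<omega>. v \<omega> $ i) \<and> (\<integral>\<omega>. v \<omega> $ i \<partial>N) = 1)"

definition iid_copies :: "'b measure \<Rightarrow> ('b \<Rightarrow> real ^ 'n::finite) \<Rightarrow>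
    'w measure \<Rightarrow> (nat \<Rightarrow> 'w \<Rightarrow> real ^ 'n) \<Rightarrow> bool" where
  "iid_copies N v M V \<longleftrightarrow>
     prob_space M \<and>
     prob_space.indep_vars M (\<lambda>_. borel) V UNIV \<and>
     (\<forall>k. distr M borel (V k) = distr N borel v)"

primrec sgd :: "('n::finite \<Rightarrow> 'a::real_inner \<Rightarrow> real) \<Rightarrow> (nat \<Rightarrow> real) \<Rightarrow>
    (nat \<Rightarrow> 'w \<Rightarrow> real ^ 'n) \<Rightarrow> 'a \<Rightarrow> nat \<Rightarrow> 'w \<Rightarrow> 'a" where
  "sgd F \<gamma> V x0 0 \<omega> = x0"
| "sgd F \<gamma> V x0 (Suc k) \<omega> =
     sgd F \<gamma> V x0 k \<omega> - \<gamma> k *\<^sub>R stoch_grad F (V k \<omega>) (sgd F \<gamma> V x0 k \<omega>)"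

definition L_smooth :: "real \<Rightarrow> ('a::real_inner \<Rightarrow> real) \<Rightarrow> bool" where
  "L_smooth L f \<longleftrightarrow>
     (\<forall>x z. f z - f x \<le> grad f x \<bullet> (z - x) + L / 2 * (norm (z - x))\<^sup>2)"

definition PL :: "real \<Rightarrow> ('a::real_inner \<Rightarrow> real) \<Rightarrow> bool" where
  "PL \<mu> f \<longleftrightarrow> (\<forall>x. (norm (grad f x))\<^sup>2 \<ge> 2 * \<mu> * (f x - min_value f))"

text \<open>Second moments are taken in \<^typ>\<open>ennreal\<close>: the Bochner integral of a non-integrable
  function is 0, which would make the two notions below vacuous in that case.\<close>

definition ER :: "real \<Rightarrow> ('n::finite \<Rightarrow> 'a::real_inner \<Rightarrow> real) \<Rightarrow>
    'b measure \<Rightarrow> ('b \<Rightarrow> real ^ 'n) \<Rightarrow> bool" where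
  "ER \<rho> F N v \<longleftrightarrow>
     (\<exists>xs\<in>minimizers (mean_fun F). \<forall>x.
        (\<integral>\<^sup>+\<omega>. ennreal ((norm (stoch_grad F (v \<omega>) x - stoch_grad F (v \<omega>) xs
                 - (grad (mean_fun F) x - grad (mean_fun F) xs)))\<^sup>2) \<partial>N)
        \<le> ennreal (2 * \<rho> * (mean_fun F x - mean_fun F xs)))"

definition gradient_noise :: "('n::finite \<Rightarrow> 'a::real_inner \<Rightarrow> real) \<Rightarrow>
    'b measure \<Rightarrow> ('b \<Rightarrow> real ^ 'n) \<Rightarrow> ennreal" where
  "gradient_noise F N v =
     (SUP xs\<in>minimizers (mean_fun F).
        (\<integral>\<^sup>+\<omega>. ennreal ((norm (stoch_grad F (v \<omega>) xs))\<^sup>2) \<partial>N))"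

text \<open>The step size \<open>(1/L) min {\<mu>\<epsilon>/(2\<sigma>\<^sup>2), 1/(1+2\<rho>/\<mu>)}\<close>, where the first entry is
  \<open>+\<infinity>\<close> for \<open>\<sigma> = 0\<close> (in HOL, division by 0 would give 0).\<close>
definition step_size :: "real \<Rightarrow> real \<Rightarrow> real \<Rightarrow> real \<Rightarrow> real \<Rightarrow> real" where
  "step_size L \<mu> \<rho> \<sigma> \<epsilon> =
     (1 / L) * (if \<sigma> = 0 then 1 / (1 + 2 * \<rho> / \<mu>)
                else min (\<mu> * \<epsilon> / (2 * \<sigma>\<^sup>2)) (1 / (1 + 2 * \<rho> / \<mu>)))"

end

theory Submission
  imports Defs
begin

text \<open>One step of SGD is analysed for a fixed iterate \<open>x\<close>. Smoothness bounds
  \<open>f (x - \<gamma> g(x)) - f\<^sup>*\<close> in terms of \<open>g(x)\<close>; since \<open>\<nabla>f\<close> vanishes at a minimizer \<open>x\<^sup>*\<close>, splitting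
  \<open>g(x) - \<nabla>f(x)\<close> into \<open>g(x) - g(x\<^sup>*) - (\<nabla>f(x) - \<nabla>f(x\<^sup>*))\<close> and \<open>g(x\<^sup>*)\<close> gives
  \<open>E \<parallel>g(x) - \<nabla>f(x)\<parallel>\<^sup>2 \<le> 4\<rho>(f(x) - f\<^sup>*) + 2\<sigma>\<^sup>2\<close>. Using PL to absorb the \<open>\<rho>\<close>-term into
  \<open>\<parallel>\<nabla>f(x)\<parallel>\<^sup>2\<close>, the step size condition makes the expected gap contract by \<open>1 - \<gamma>\<mu>\<close> up to an
  additive \<open>L\<gamma>\<^sup>2\<sigma>\<^sup>2\<close>. As \<open>x\<^sup>k\<close> depends on \<open>v\<^sup>0, \<dots>, v\<^sup>k\<^sup>-\<^sup>1\<close> only, it is independent of \<open>v\<^sup>k\<close>, so the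
  bound can be integrated over \<open>x\<^sup>k\<close> and iterated. All expectations are computed as
  nonnegative integrals, so that integrability is a conclusion.\<close>

section \<open>Gradients and their linearity\<close>

lemma GDERIV_imp_grad:
  assumes "GDERIV f x :> D"
  shows "grad f x = D"
  unfolding grad_def
proof (rule the_equality)
  fix D' assume "GDERIV f x :> D'"
  with assms have "(\<lambda>h. inner h D') = (\<lambda>h. inner h D)"
    unfolding gderiv_def by (rule has_derivative_unique[rotated])
  then have "inner (D' - D) D' = inner (D' - D) D" by metis
  then show "D' = D" by (metis inner_diff_right inner_eq_zero_iff right_minus_eq)
qed (rule assms)

lemma differentiable_imp_GDERIV:
  fixes f :: "'a::euclidean_space \<Rightarrow> real"
  assumes "f differentiable (at x)"
  shows "GDERIV f x :> grad f x"
proof -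
  obtain f' where f': "(f has_derivative f') (at x)"
    using assms by (auto simp: differentiable_def)
  \<comment> \<open>Riesz representation: the functional \<open>f'\<close> is the inner product with
    \<open>adjoint f' 1\<close>, which is therefore the gradient.\<close>
  have "h \<bullet> adjoint f' 1 = f' h" for h
    using adjoint_works[OF has_derivative_linear[OF f'], of h 1] by simp
  with f' have "GDERIV f x :> adjoint f' 1"
    by (simp add: gderiv_def)
  then show ?thesis using GDERIV_imp_grad by metis
qed

lemma GDERIV_sum:
  assumes "\<And>i. i \<in> I \<Longrightarrow> GDERIV (f i) x :> D i"
  shows "GDERIV (\<lambda>x. \<Sum>i\<in>I. f i x) x :> (\<Sum>i\<in>I. D i)"
  using assms unfolding gderiv_def inner_sum_right by (rule has_derivative_sum)

lemma GDERIV_cmult: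
  assumes "GDERIV f x :> D"
  shows "GDERIV (\<lambda>x. c * f x) x :> c *\<^sub>R D"
  using assms unfolding gderiv_def inner_scaleR_right by (rule has_derivative_mult_right)

text \<open>The formula is linear in \<open>w\<close> with the vectors \<open>grad (F i) x\<close>
  as coefficients. It yields joint measurability in \<open>w\<close> and \<open>x\<close> and, when
  the \<open>w $ i\<close> have mean 1, unbiasedness of the stochastic gradient.\<close>

lemma stoch_grad_eq:
  fixes F :: "'n::finite \<Rightarrow> 'a::euclidean_space \<Rightarrow> real"
  assumes "\<And>i. F i differentiable (at x)"
  shows "stoch_grad F w x = (1 / real CARD('n)) *\<^sub>R (\<Sum>i\<in>UNIV. w $ i *\<^sub>R grad (F i) x)"
  unfolding stoch_grad_def
  by (rule GDERIV_imp_grad)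
     (unfold reweighted_fun_def,
      intro GDERIV_cmult GDERIV_sum differentiable_imp_GDERIV assms)

lemma grad_mean_fun_eq:
  fixes F :: "'n::finite \<Rightarrow> 'a::euclidean_space \<Rightarrow> real"
  assumes "\<And>i. F i differentiable (at x)"
  shows "grad (mean_fun F) x = (1 / real CARD('n)) *\<^sub>R (\<Sum>i\<in>UNIV. grad (F i) x)"
  by (rule GDERIV_imp_grad)
     (unfold mean_fun_def,
      intro GDERIV_cmult GDERIV_sum differentiable_imp_GDERIV assms)

section \<open>Measurability of gradients and iterates\<close>

lemma borel_measurable_differentiable:
  fixes f :: "'a::euclidean_space \<Rightarrow> real"
  assumes "\<And>x. f differentiable (at x)"
  shows "f \<in> borel_measurable borel"
proof (rule borel_measurable_continuous_onI)
  have "f differentiable_on UNIV"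
    unfolding differentiable_on_def by (intro ballI assms)
  then show "continuous_on UNIV f"
    by (rule differentiable_imp_continuous_on)
qed

text \<open>Each component of the gradient is a directional derivative, hence the pointwise limit of
  difference quotients at \<open>1 / real (Suc n)\<close>, which are measurable because
  \<open>f\<close> is. This replaces continuity of the gradient, which mere differentiability does
  not give.\<close>

lemma borel_measurable_grad:
  fixes f :: "'a::euclidean_space \<Rightarrow> real"
  assumes diff: "\<And>x. f differentiable (at x)"
  shows "grad f \<in> borel_measurable borel"
proof (rule borel_measurable_euclidean_space[THEN iffD2, rule_format])
  fix b :: 'a
  have [measurable]: "f \<in> borel_measurable borel"
    by (rule borel_measurable_differentiable) (rule diff)
  let ?t = "\<lambda>n. 1 / real (Suc n)"
  show "(\<lambda>x. grad f x \<bullet> b) \<in> borel_measurable borel"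
  proof (rule borel_measurable_LIMSEQ_real)
    fix x
    have "(f has_derivative (\<lambda>h. h \<bullet> grad f x)) (at (x + 0 *\<^sub>R b))"
      using differentiable_imp_GDERIV[OF diff] by (simp add: gderiv_def)
    moreover have "((\<lambda>t. x + t *\<^sub>R b) has_derivative (\<lambda>t. t *\<^sub>R b)) (at 0)"
      by (auto intro!: derivative_eq_intros)
    ultimately have "((\<lambda>t. f (x + t *\<^sub>R b)) has_derivative (\<lambda>t. (t *\<^sub>R b) \<bullet> grad f x)) (at 0)"
      by (rule has_derivative_compose[rotated])
    then have "DERIV (\<lambda>t. f (x + t *\<^sub>R b)) 0 :> grad f x \<bullet> b"
      by (rule has_derivative_imp_has_field_derivative) (simp add: inner_commute)
    then have "((\<lambda>t. (f (x + t *\<^sub>R b) - f x) / t) \<longlongrightarrow> grad f x \<bullet> b) (at 0)"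
      by (simp add: DERIV_def)
    moreover have "filterlim ?t (at 0) sequentially"
      unfolding filterlim_at
      using LIMSEQ_inverse_real_of_nat by (simp add: inverse_eq_divide)
    ultimately show "(\<lambda>n. (f (x + ?t n *\<^sub>R b) - f x) / ?t n) \<longlonglongrightarrow> grad f x \<bullet> b"
      by (rule filterlim_compose)
  qed measurable
qed

lemma borel_measurable_mean_fun:
  fixes F :: "'n::finite \<Rightarrow> 'a::euclidean_space \<Rightarrow> real"
  assumes "\<And>i x. F i differentiable (at x)"
  shows "mean_fun F \<in> borel_measurable borel"
proof -
  have [measurable]: "F i \<in> borel_measurable borel" for i
    by (rule borel_measurable_differentiable) (rule assms)
  show ?thesis unfolding mean_fun_def by measurable
qed

lemma borel_measurable_stoch_grad:
  fixes F :: "'n::finite \<Rightarrow> 'a::euclidean_space \<Rightarrow> real"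
  assumes "\<And>i x. F i differentiable (at x)"
    and [measurable]: "W \<in> borel_measurable M" "X \<in> borel_measurable M"
  shows "(\<lambda>\<omega>. stoch_grad F (W \<omega>) (X \<omega>)) \<in> borel_measurable M"
proof -
  have [measurable]: "grad (F i) \<in> borel_measurable borel" for i
    by (rule borel_measurable_grad) (rule assms)
  have [measurable]: "(\<lambda>w. w $ i) \<in> borel_measurable borel" for i :: 'n
    by (intro borel_measurable_continuous_onI continuous_intros)
  show ?thesis
    unfolding stoch_grad_eq[OF assms(1)] by measurable
qed

text \<open>Only the \<open>V j\<close> with \<open>j < k\<close> are asked to be measurable, so
  that the lemma also applies on the product space over \<open>{..<k}\<close> with the coordinate
  projections as \<open>V\<close>.\<close>

lemma borel_measurable_sgd:
  fixes F :: "'n::finite \<Rightarrow> 'a::euclidean_space \<Rightarrow> real"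
  assumes "\<And>i x. F i differentiable (at x)"
    and "\<And>j. j < k \<Longrightarrow> V j \<in> borel_measurable M"
  shows "sgd F \<gamma> V x0 k \<in> borel_measurable M"
  using assms(2)
proof (induction k)
  case 0
  have "sgd F \<gamma> V x0 0 = (\<lambda>_. x0)" by auto
  then show ?case by simp
next
  case (Suc k)
  then have [measurable]: "sgd F \<gamma> V x0 k \<in> borel_measurable M" "V k \<in> borel_measurable M"
    by auto
  have [measurable]: "(\<lambda>\<omega>. stoch_grad F (V k \<omega>) (sgd F \<gamma> V x0 k \<omega>)) \<in> borel_measurable M"
    by (intro borel_measurable_stoch_grad assms(1)) measurable
  have "sgd F \<gamma> V x0 (Suc k)
      = (\<lambda>\<omega>. sgd F \<gamma> V x0 k \<omega> - \<gamma> k *\<^sub>R stoch_grad F (V k \<omega>) (sgd F \<gamma> V x0 k \<omega>))"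
    by auto
  then show ?case by simp
qed

section \<open>Independence of the iterate from the next sample\<close>

lemma sgd_cong:
  assumes "\<And>j. j < k \<Longrightarrow> V j \<omega> = W j \<omega>'"
  shows "sgd F \<gamma> V x0 k \<omega> = sgd F \<gamma> W x0 k \<omega>'"
  using assms by (induction k) auto

text \<open>By independence the joint law is the product of the two laws, and Tonelli's theorem
  separates the integrations.\<close>

lemma (in prob_space) nn_integral_indep_var:
  assumes indep: "indep_var S X T Y"
    and [measurable]: "h \<in> borel_measurable (S \<Otimes>\<^sub>M T)"
  shows "(\<integral>\<^sup>+\<omega>. h (X \<omega>, Y \<omega>) \<partial>M) = (\<integral>\<^sup>+\<omega>. (\<integral>\<^sup>+\<omega>'. h (X \<omega>, Y \<omega>') \<partial>M) \<partial>M)"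
proof -
  have [measurable]: "X \<in> measurable M S" "Y \<in> measurable M T"
    and eq: "distr M S X \<Otimes>\<^sub>M distr M T Y = distr M (S \<Otimes>\<^sub>M T) (\<lambda>\<omega>. (X \<omega>, Y \<omega>))"
    using indep by (simp_all add: indep_var_distribution_eq)
  interpret Y: prob_space "distr M T Y" by (rule prob_space_distr) measurable
  have "(\<integral>\<^sup>+\<omega>. h (X \<omega>, Y \<omega>) \<partial>M) = (\<integral>\<^sup>+z. h z \<partial>(distr M S X \<Otimes>\<^sub>M distr M T Y))"
    by (simp add: eq nn_integral_distr)
  also have "\<dots> = (\<integral>\<^sup>+x. (\<integral>\<^sup>+y. h (x, y) \<partial>distr M T Y) \<partial>distr M S X)"
    by (rule Y.nn_integral_fst[symmetric]) simp
  also have "\<dots> = (\<integral>\<^sup>+\<omega>. (\<integral>\<^sup>+y. h (X \<omega>, y) \<partial>distr M T Y) \<partial>M)"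
    by (rule nn_integral_distr) measurable
  also have "\<dots> = (\<integral>\<^sup>+\<omega>. (\<integral>\<^sup>+\<omega>'. h (X \<omega>, Y \<omega>') \<partial>M) \<partial>M)"
  proof (rule nn_integral_cong)
    fix \<omega> assume "\<omega> \<in> space M"
    then have [measurable]: "X \<omega> \<in> space S" by (rule measurable_space[rotated]) measurable
    show "(\<integral>\<^sup>+y. h (X \<omega>, y) \<partial>distr M T Y) = (\<integral>\<^sup>+\<omega>'. h (X \<omega>, Y \<omega>') \<partial>M)"
      by (rule nn_integral_distr) measurable
  qed
  finally show ?thesis .
qed

text \<open>\<^const>\<open>prob_space.indep_var\<close> wants both variables of the same type, so independence is used
  for the two restrictions of \<open>V\<close>, of which \<open>x\<^sup>k\<close> and \<open>v\<^sup>k\<close> are functions.\<close>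
lemma nn_integral_sgd_step:
  fixes F :: "'n::finite \<Rightarrow> 'a::euclidean_space \<Rightarrow> real"
  assumes diff: "\<And>i x. F i differentiable (at x)"
    and iid: "iid_copies N v M V"
    and v: "v \<in> borel_measurable N"
    and h[measurable]: "h \<in> borel_measurable (borel \<Otimes>\<^sub>M borel)"
  shows "(\<integral>\<^sup>+\<omega>. h (sgd F \<gamma> V x0 k \<omega>, V k \<omega>) \<partial>M)
    = (\<integral>\<^sup>+\<omega>. (\<integral>\<^sup>+\<omega>'. h (sgd F \<gamma> V x0 k \<omega>, v \<omega>') \<partial>N) \<partial>M)"
proof -
  interpret prob_space M using iid by (simp add: iid_copies_def)
  have indep: "indep_vars (\<lambda>_. borel) V UNIV" and dist: "distr M borel (V k) = distr N borel v"
    using iid by (simp_all add: iid_copies_def)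
  then have [measurable]: "V j \<in> borel_measurable M" for j
    by (simp add: indep_vars_def)
  let ?P = "\<lambda>J :: nat set. PiM J (\<lambda>_. borel :: (real ^ 'n) measure)"
  let ?R = "\<lambda>J \<omega>. restrict (\<lambda>j. V j \<omega>) J"
  \<comment> \<open>\<open>?S\<close> runs SGD on a sequence of samples that is itself the argument.
    This exhibits the iterate as a measurable function of the restriction of \<open>V\<close> to
    \<open>{..<k}\<close>.\<close>
  let ?S = "sgd F \<gamma> (\<lambda>j y. y j) x0 k"
  have [measurable]: "?S \<in> borel_measurable (?P {..<k})"
    by (intro borel_measurable_sgd diff) auto
  \<comment> \<open>The first \<open>k\<close> steps read only \<open>V j\<close> with
    \<open>j < k\<close>, so the restriction changes nothing.\<close>
  have S: "?S (?R {..<k} \<omega>) = sgd F \<gamma> V x0 k \<omega>" for \<omega>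
    by (auto intro!: sgd_cong)
  have "(\<integral>\<^sup>+\<omega>. (\<lambda>(y, z). h (?S y, z k)) (?R {..<k} \<omega>, ?R {k} \<omega>) \<partial>M)
    = (\<integral>\<^sup>+\<omega>. (\<integral>\<^sup>+\<omega>'. (\<lambda>(y, z). h (?S y, z k)) (?R {..<k} \<omega>, ?R {k} \<omega>') \<partial>M) \<partial>M)"
    by (rule nn_integral_indep_var[OF indep_var_restrict[OF indep, of "{..<k}" "{k}"]])
       (auto simp: case_prod_beta intro!: measurable_compose[OF _ h] measurable_Pair
          measurable_compose[OF measurable_fst] measurable_compose[OF measurable_snd])
  moreover have "(\<integral>\<^sup>+\<omega>'. h (x, V k \<omega>') \<partial>M) = (\<integral>\<^sup>+\<omega>'. h (x, v \<omega>') \<partial>N)" for x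
  proof -
    have "(\<integral>\<^sup>+\<omega>'. h (x, V k \<omega>') \<partial>M) = (\<integral>\<^sup>+w. h (x, w) \<partial>distr M borel (V k))"
      by (simp add: nn_integral_distr)
    also have "\<dots> = (\<integral>\<^sup>+\<omega>'. h (x, v \<omega>') \<partial>N)"
      using v unfolding dist by (simp add: nn_integral_distr)
    finally show ?thesis .
  qed
  ultimately show ?thesis by (simp add: S)
qed

section \<open>Minimum value and consequences of smoothness\<close>

lemma min_value_le:
  assumes "minimizers f \<noteq> {}"
  shows "min_value f \<le> f x"
proof -
  from assms obtain xs where "\<forall>x. f xs \<le> f x"
    by (auto simp: minimizers_def is_arg_min_linorder)
  then show ?thesis
    unfolding min_value_def by (intro cINF_lower bdd_belowI2) auto
qed

lemma min_value_eq:
  assumes "xs \<in> minimizers f"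
  shows "min_value f = f xs"
proof (rule antisym)
  show "min_value f \<le> f xs" using assms by (intro min_value_le) auto
  show "f xs \<le> min_value f" using assms
    unfolding min_value_def by (intro cINF_greatest) (auto simp: minimizers_def is_arg_min_linorder)
qed

text \<open>The smoothness inequality is taken at the gradient step of length \<open>1 / L\<close>,
  which minimizes its right-hand side, while \<open>m\<close> bounds the value there from
  below.\<close>

lemma L_smooth_grad_le:
  assumes "L > 0" "L_smooth L f" "\<And>z. m \<le> f z"
  shows "(norm (grad f x))\<^sup>2 \<le> 2 * L * (f x - m)"
proof -
  let ?z = "x - (1 / L) *\<^sub>R grad f x"
  have "m - f x \<le> f ?z - f x" using assms(3) by simp
  also have "\<dots> \<le> grad f x \<bullet> (?z - x) + L / 2 * (norm (?z - x))\<^sup>2"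
    using assms(2) unfolding L_smooth_def by blast
  also have "\<dots> = - (norm (grad f x))\<^sup>2 / (2 * L)"
    using \<open>L > 0\<close> by (simp add: power_divide dot_square_norm field_simps power2_eq_square)
  finally show ?thesis using \<open>L > 0\<close> by (simp add: field_simps)
qed

text \<open>The two sides differ by \<open>(norm (a - b))\<^sup>2\<close>.\<close>

lemma norm_add_sq_le:
  fixes a b :: "'a::real_inner"
  shows "(norm (a + b))\<^sup>2 \<le> 2 * (norm a)\<^sup>2 + 2 * (norm b)\<^sup>2"
  using zero_le_power2[of "norm (a - b)"]
  by (simp add: power2_norm_eq_inner inner_simps inner_commute)

section \<open>Variance bound and one-step decrease\<close>

lemma expected_residual_variance:
  fixes F :: "'n::finite \<Rightarrow> 'a::euclidean_space \<Rightarrow> real"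
  assumes diff: "\<And>i x. F i differentiable (at x)"
    and v: "sampling_vector N v"
    and noise: "gradient_noise F N v = ennreal (\<sigma>\<^sup>2)"
    and L: "L > 0" "L_smooth L (mean_fun F)"
    and "\<rho> \<ge> 0" and ER: "ER \<rho> F N v"
  shows "(\<integral>\<^sup>+\<omega>. ennreal ((norm (stoch_grad F (v \<omega>) x - grad (mean_fun F) x))\<^sup>2) \<partial>N)
    \<le> ennreal (4 * \<rho> * (mean_fun F x - min_value (mean_fun F)) + 2 * \<sigma>\<^sup>2)"
proof -
  let ?f = "mean_fun F" and ?g = "\<lambda>\<omega>. stoch_grad F (v \<omega>)"
  obtain xs where xs: "xs \<in> minimizers ?f" and
    res: "(\<integral>\<^sup>+\<omega>. ennreal ((norm (?g \<omega> x - ?g \<omega> xs - (grad ?f x - grad ?f xs)))\<^sup>2) \<partial>N)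
      \<le> ennreal (2 * \<rho> * (?f x - ?f xs))"
    using ER unfolding ER_def by blast
  have le: "?f xs \<le> ?f z" for z
    using xs by (simp add: minimizers_def is_arg_min_linorder)
  \<comment> \<open>With \<open>m\<close> chosen as the minimum, the right-hand side of
    \<open>L_smooth_grad_le\<close> is 0 at \<open>xs\<close>.\<close>
  have [simp]: "grad ?f xs = 0"
    using L_smooth_grad_le[OF L, of "?f xs" xs] le by simp
  have [measurable]: "v \<in> borel_measurable N"
    using v by (simp add: sampling_vector_def)
  have [measurable]: "(\<lambda>\<omega>. ?g \<omega> z) \<in> borel_measurable N" for z
    by (intro borel_measurable_stoch_grad diff) auto
  let ?a = "\<lambda>\<omega>. ennreal ((norm (?g \<omega> x - ?g \<omega> xs - grad ?f x))\<^sup>2)"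
  let ?b = "\<lambda>\<omega>. ennreal ((norm (?g \<omega> xs))\<^sup>2)"
  \<comment> \<open>The supremum in the noise covers whichever minimizer ER provides.\<close>
  have b: "(\<integral>\<^sup>+\<omega>. ?b \<omega> \<partial>N) \<le> ennreal (\<sigma>\<^sup>2)"
    unfolding noise[symmetric] gradient_noise_def using xs by (rule SUP_upper)
  have double: "2 * ennreal s + 2 * ennreal t = ennreal (2 * s + 2 * t)" if "0 \<le> s" "0 \<le> t" for s t
    using that by (simp add: ennreal_mult')
  have "ennreal ((norm (?g \<omega> x - grad ?f x))\<^sup>2) \<le> 2 * ?a \<omega> + 2 * ?b \<omega>" for \<omega>
  proof -
    have "(norm (?g \<omega> x - grad ?f x))\<^sup>2
        \<le> 2 * (norm (?g \<omega> x - ?g \<omega> xs - grad ?f x))\<^sup>2 + 2 * (norm (?g \<omega> xs))\<^sup>2"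
      using norm_add_sq_le[of "?g \<omega> x - ?g \<omega> xs - grad ?f x" "?g \<omega> xs"] by (simp add: algebra_simps)
    from ennreal_leI[OF this] show ?thesis
      by (simp add: double)
  qed
  then have "(\<integral>\<^sup>+\<omega>. ennreal ((norm (?g \<omega> x - grad ?f x))\<^sup>2) \<partial>N) \<le> (\<integral>\<^sup>+\<omega>. 2 * ?a \<omega> + 2 * ?b \<omega> \<partial>N)"
    by (intro nn_integral_mono)
  also have "\<dots> = 2 * (\<integral>\<^sup>+\<omega>. ?a \<omega> \<partial>N) + 2 * (\<integral>\<^sup>+\<omega>. ?b \<omega> \<partial>N)"
    by (simp add: nn_integral_add nn_integral_cmult)
  also have "\<dots> \<le> 2 * ennreal (2 * \<rho> * (?f x - ?f xs)) + 2 * ennreal (\<sigma>\<^sup>2)"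
    using res b by (intro add_mono mult_left_mono) auto
  also have "\<dots> = ennreal (2 * (2 * \<rho> * (?f x - ?f xs)) + 2 * \<sigma>\<^sup>2)"
    using le[of x] \<open>\<rho> \<ge> 0\<close> by (intro double) auto
  finally show ?thesis
    by (simp add: min_value_eq[OF xs] mult.assoc)
qed

lemma sgd_step_bound:
  fixes F :: "'n::finite \<Rightarrow> 'a::euclidean_space \<Rightarrow> real"
  defines "f \<equiv> mean_fun F"
  assumes diff: "\<And>i x. F i differentiable (at x)"
    and ne: "minimizers f \<noteq> {}"
    and v: "sampling_vector N v"
    and noise: "gradient_noise F N v = ennreal (\<sigma>\<^sup>2)"
    and L: "L > 0" "L_smooth L f"
    and PL: "\<mu> > 0" "PL \<mu> f"
    and ER: "\<rho> \<ge> 0" "ER \<rho> F N v"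
    and \<gamma>: "0 < \<gamma>" "\<gamma> \<le> 1 / (1 + 2 * \<rho> / \<mu>) * (1 / L)"
  shows "(\<integral>\<^sup>+\<omega>. ennreal (f (x - \<gamma> *\<^sub>R stoch_grad F (v \<omega>) x) - min_value f) \<partial>N)
    \<le> ennreal ((1 - \<gamma> * \<mu>) * (f x - min_value f) + L * \<gamma>\<^sup>2 * \<sigma>\<^sup>2)"
proof -
  interpret prob_space N using v by (simp add: sampling_vector_def)
  let ?g = "\<lambda>\<omega>. stoch_grad F (v \<omega>) x"
  define G where "G = grad f x"
  define \<Delta> where "\<Delta> = f x - min_value f"
  have \<Delta>: "0 \<le> \<Delta>" using min_value_le[OF ne, of x] by (simp add: \<Delta>_def)
  have [measurable]: "v \<in> borel_measurable N"
    using v by (simp add: sampling_vector_def)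
  have [measurable]: "?g \<in> borel_measurable N"
    by (intro borel_measurable_stoch_grad diff) auto
  have g_int: "integrable N ?g" and g_mean: "integral\<^sup>L N ?g = G"
    using v by (auto simp: stoch_grad_eq diff sampling_vector_def G_def f_def grad_mean_fun_eq)
  define S where "S = (\<lambda>\<omega>. (norm (?g \<omega> - G))\<^sup>2)"
  have [measurable]: "S \<in> borel_measurable N" by (simp add: S_def)
  have S_nn: "(\<integral>\<^sup>+\<omega>. ennreal (S \<omega>) \<partial>N) \<le> ennreal (4 * \<rho> * \<Delta> + 2 * \<sigma>\<^sup>2)"
    unfolding S_def G_def \<Delta>_def f_def
    by (rule expected_residual_variance[OF diff v noise L[unfolded f_def] ER])
  have S_int: "integrable N S"
    by (rule integrableI_nonneg) (auto simp: S_def intro: le_less_trans[OF S_nn[unfolded S_def]])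
  have S_mean: "integral\<^sup>L N S \<le> 4 * \<rho> * \<Delta> + 2 * \<sigma>\<^sup>2"
    using S_nn S_int \<Delta> ER(1) by (simp add: nn_integral_eq_integral S_def del: ennreal_plus)
  \<comment> \<open>\<open>q\<close> is the smoothness bound with
    \<open>(norm (?g \<omega>))\<^sup>2\<close> expressed through \<open>S\<close>, whose integral
    is already controlled. It dominates a nonnegative gap, so its Bochner and nonnegative integrals
    agree.\<close>
  define q where "q = (\<lambda>\<omega>. \<Delta> - \<gamma> * (G \<bullet> ?g \<omega>) + L * \<gamma>\<^sup>2 / 2 * (S \<omega> + 2 * (G \<bullet> ?g \<omega>) - (norm G)\<^sup>2))"
  have q: "f (x - \<gamma> *\<^sub>R ?g \<omega>) - min_value f \<le> q \<omega>" for \<omega>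
  proof -
    have "f (x - \<gamma> *\<^sub>R ?g \<omega>) - f x \<le> G \<bullet> (x - \<gamma> *\<^sub>R ?g \<omega> - x) + L / 2 * (norm (x - \<gamma> *\<^sub>R ?g \<omega> - x))\<^sup>2"
      using L(2) unfolding L_smooth_def G_def by blast
    also have "\<dots> = - \<gamma> * (G \<bullet> ?g \<omega>) + L * \<gamma>\<^sup>2 / 2 * (norm (?g \<omega>))\<^sup>2"
      by (simp add: power_mult_distrib)
    also have "(norm (?g \<omega>))\<^sup>2 = S \<omega> + 2 * (G \<bullet> ?g \<omega>) - (norm G)\<^sup>2"
      by (simp add: S_def power2_norm_eq_inner inner_simps inner_commute)
    finally show ?thesis by (simp add: q_def \<Delta>_def)
  qed
  have q_nonneg: "0 \<le> q \<omega>" for \<omega>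
    using q[of \<omega>] min_value_le[OF ne, of "x - \<gamma> *\<^sub>R ?g \<omega>"] by simp
  have q_int: "integrable N q"
    unfolding q_def using g_int S_int
    by (intro Bochner_Integration.integrable_add Bochner_Integration.integrable_diff
          integrable_mult_right integrable_inner_right) auto
  \<comment> \<open>Unbiasedness gives \<open>G \<bullet> ?g \<omega>\<close> the mean
    \<open>(norm G)\<^sup>2\<close>.\<close>
  have "integral\<^sup>L N q = \<Delta> - \<gamma> * (norm G)\<^sup>2 + L * \<gamma>\<^sup>2 / 2 * (integral\<^sup>L N S + (norm G)\<^sup>2)"
    unfolding q_def using g_int S_int
    by (simp add: g_mean prob_space power2_norm_eq_inner)
  also have "\<dots> \<le> \<Delta> - \<gamma> * (norm G)\<^sup>2 + L * \<gamma>\<^sup>2 / 2 * (4 * \<rho> * \<Delta> + 2 * \<sigma>\<^sup>2 + (norm G)\<^sup>2)"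
    using S_mean L(1) by (intro add_left_mono mult_left_mono add_right_mono) auto
  also have "\<dots> \<le> (1 - \<gamma> * \<mu>) * \<Delta> + L * \<gamma>\<^sup>2 * \<sigma>\<^sup>2"
  proof -
    \<comment> \<open>PL enters twice: first to trade the \<rho>-term for a multiple of
      \<open>(norm G)\<^sup>2\<close>, and at the end to turn the remaining decrease into
      \<open>\<gamma> * \<mu> * \<Delta>\<close>.\<close>
    have G: "2 * \<mu> * \<Delta> \<le> (norm G)\<^sup>2"
      using PL(2) by (simp add: PL_def G_def \<Delta>_def)
    have "4 * \<rho> * \<Delta> = 2 * \<rho> / \<mu> * (2 * \<mu> * \<Delta>)" using PL(1) by simp
    also have "\<dots> \<le> 2 * \<rho> / \<mu> * (norm G)\<^sup>2"
      using G PL(1) ER(1) by (intro mult_left_mono) auto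
    finally have *: "4 * \<rho> * \<Delta> + (norm G)\<^sup>2 \<le> (1 + 2 * \<rho> / \<mu>) * (norm G)\<^sup>2"
      by (simp add: algebra_simps)
    have A: "0 < 1 + 2 * \<rho> / \<mu>" (is "0 < ?A") using PL(1) ER(1) by (simp add: add_pos_nonneg)
    \<comment> \<open>Here the step size condition enters: with
      \<open>L * \<gamma> * ?A \<le> 1\<close>, the second-order term apart from the noise consumes
      at most half of the decrease \<open>\<gamma> * (norm G)\<^sup>2\<close>.\<close>
    have "L * \<gamma> * ?A \<le> L * (1 / ?A * (1 / L)) * ?A"
      using \<gamma>(2) A L(1) by (intro mult_right_mono mult_left_mono) auto
    also have "\<dots> = 1" using less_imp_neq[OF A] L(1) by simp
    finally have **: "L * \<gamma> * ?A \<le> 1" .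
    have "L * \<gamma>\<^sup>2 / 2 * (4 * \<rho> * \<Delta> + (norm G)\<^sup>2) \<le> L * \<gamma>\<^sup>2 / 2 * ((1 + 2 * \<rho> / \<mu>) * (norm G)\<^sup>2)"
      using * L(1) by (intro mult_left_mono) auto
    also have "\<dots> = \<gamma> / 2 * (norm G)\<^sup>2 * (L * \<gamma> * (1 + 2 * \<rho> / \<mu>))"
      by (simp add: power2_eq_square mult_ac)
    also have "\<dots> \<le> \<gamma> / 2 * (norm G)\<^sup>2"
      using ** \<gamma>(1) by (intro mult_left_le) auto
    finally have "\<Delta> - \<gamma> * (norm G)\<^sup>2 + L * \<gamma>\<^sup>2 / 2 * (4 * \<rho> * \<Delta> + 2 * \<sigma>\<^sup>2 + (norm G)\<^sup>2)
        \<le> \<Delta> - \<gamma> / 2 * (norm G)\<^sup>2 + L * \<gamma>\<^sup>2 * \<sigma>\<^sup>2"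
      by (simp add: algebra_simps)
    also have "\<dots> \<le> \<Delta> - \<gamma> / 2 * (2 * \<mu> * \<Delta>) + L * \<gamma>\<^sup>2 * \<sigma>\<^sup>2"
      using G \<gamma>(1) by (intro add_right_mono diff_left_mono mult_left_mono) auto
    finally show ?thesis by (simp add: algebra_simps)
  qed
  finally have mean: "integral\<^sup>L N q \<le> (1 - \<gamma> * \<mu>) * \<Delta> + L * \<gamma>\<^sup>2 * \<sigma>\<^sup>2" .
  have "(\<integral>\<^sup>+\<omega>. ennreal (f (x - \<gamma> *\<^sub>R ?g \<omega>) - min_value f) \<partial>N) \<le> (\<integral>\<^sup>+\<omega>. ennreal (q \<omega>) \<partial>N)"
    by (intro nn_integral_mono ennreal_leI q)
  also have "\<dots> = ennreal (integral\<^sup>L N q)"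
    using q_int q_nonneg by (simp add: nn_integral_eq_integral)
  also have "\<dots> \<le> ennreal ((1 - \<gamma> * \<mu>) * \<Delta> + L * \<gamma>\<^sup>2 * \<sigma>\<^sup>2)"
    using mean by (rule ennreal_leI)
  finally show ?thesis by (simp add: \<Delta>_def)
qed

section \<open>Iterated bound and integrability\<close>

text \<open>If \<open>\<mu> > L\<close>, then \<open>f\<close> is constant and \<open>1 - \<gamma>\<mu>\<close> may be negative.\<close>
lemma PL_L_smooth_contraction:
  assumes ne: "minimizers f \<noteq> {}"
    and L: "L > 0" "L_smooth L f"
    and PL: "\<mu> > 0" "PL \<mu> f"
    and \<gamma>: "0 \<le> \<gamma>" "\<gamma> * L \<le> 1"
  shows "\<gamma> * \<mu> \<le> 1 \<or> (\<forall>x. f x = min_value f)"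
proof (rule disjCI)
  assume "\<not> (\<forall>x. f x = min_value f)"
  then obtain x where x: "f x > min_value f"
    using min_value_le[OF ne] by (metis order_le_less)
  \<comment> \<open>PL and smoothness enclose the squared gradient norm between
    \<open>2 * \<mu>\<close> and \<open>2 * L\<close> times the gap, so one point with positive gap
    forces \<open>\<mu> \<le> L\<close>.\<close>
  have "2 * \<mu> * (f x - min_value f) \<le> (norm (grad f x))\<^sup>2"
    using PL(2) by (simp add: PL_def)
  also have "\<dots> \<le> 2 * L * (f x - min_value f)"
    by (intro L_smooth_grad_le L min_value_le ne)
  finally have "\<mu> \<le> L" using x by simp
  then have "\<gamma> * \<mu> \<le> \<gamma> * L" using \<gamma>(1) by (rule mult_left_mono)
  with \<gamma>(2) show "\<gamma> * \<mu> \<le> 1" by simp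
qed

text \<open>The one-step bound is averaged over the current iterate. Since \<open>ennreal\<close>
  truncates negative reals to 0, \<open>contr\<close> is what lets the affine bound split into sums
  and products there.\<close>

lemma sgd_nn_integral_bound:
  fixes F :: "'n::finite \<Rightarrow> 'a::euclidean_space \<Rightarrow> real"
  defines "f \<equiv> mean_fun F"
  assumes diff: "\<And>i x. F i differentiable (at x)"
    and ne: "minimizers f \<noteq> {}"
    and v: "sampling_vector N v"
    and iid: "iid_copies N v M V"
    and noise: "gradient_noise F N v = ennreal (\<sigma>\<^sup>2)"
    and L: "L > 0" "L_smooth L f"
    and PL: "\<mu> > 0" "PL \<mu> f"
    and ER: "\<rho> \<ge> 0" "ER \<rho> F N v"
    and \<gamma>: "0 < \<gamma>" "\<gamma> \<le> 1 / (1 + 2 * \<rho> / \<mu>) * (1 / L)"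
    and contr: "\<gamma> * \<mu> \<le> 1"
  shows "(\<integral>\<^sup>+\<omega>. ennreal (f (sgd F (\<lambda>_. \<gamma>) V x0 k \<omega>) - min_value f) \<partial>M)
    \<le> ennreal ((1 - \<gamma> * \<mu>) ^ k * (f x0 - min_value f) + L * \<gamma> * \<sigma>\<^sup>2 / \<mu>)"
proof (induction k)
  interpret prob_space M using iid by (simp add: iid_copies_def)
  case 0
  show ?case using L PL \<gamma> by (simp add: emeasure_space_1 ennreal_leI)
next
  interpret prob_space M using iid by (simp add: iid_copies_def)
  case (Suc k)
  let ?x = "sgd F (\<lambda>_. \<gamma>) V x0" and ?m = "min_value f"
  let ?c = "1 - \<gamma> * \<mu>" and ?s = "L * \<gamma>\<^sup>2 * \<sigma>\<^sup>2"
  have le: "?m \<le> f z" for z by (rule min_value_le[OF ne])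
  have [measurable]: "f \<in> borel_measurable borel"
    unfolding f_def by (rule borel_measurable_mean_fun) (rule diff)
  have [measurable]: "V j \<in> borel_measurable M" for j
    using iid by (simp add: iid_copies_def indep_vars_def)
  have [measurable]: "?x k \<in> borel_measurable M"
    by (intro borel_measurable_sgd diff) measurable
  have [measurable]: "(\<lambda>z. stoch_grad F (snd z) (fst z)) \<in> borel_measurable (borel \<Otimes>\<^sub>M borel)"
    by (intro borel_measurable_stoch_grad diff) measurable
  let ?h = "\<lambda>z. ennreal (f (fst z - \<gamma> *\<^sub>R stoch_grad F (snd z) (fst z)) - ?m)"
  have "(\<integral>\<^sup>+\<omega>. ennreal (f (?x (Suc k) \<omega>) - ?m) \<partial>M) = (\<integral>\<^sup>+\<omega>. ?h (?x k \<omega>, V k \<omega>) \<partial>M)"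
    by simp
  also have "\<dots> = (\<integral>\<^sup>+\<omega>. (\<integral>\<^sup>+\<omega>'. ?h (?x k \<omega>, v \<omega>') \<partial>N) \<partial>M)"
    using v by (intro nn_integral_sgd_step diff iid) (auto simp: sampling_vector_def)
  also have "\<dots> \<le> (\<integral>\<^sup>+\<omega>. ennreal (?c * (f (?x k \<omega>) - ?m) + ?s) \<partial>M)"
    using sgd_step_bound[OF diff ne[unfolded f_def] v noise L[unfolded f_def] PL[unfolded f_def] ER \<gamma>]
    by (intro nn_integral_mono) (simp add: f_def)
  also have "\<dots> = (\<integral>\<^sup>+\<omega>. ennreal ?c * ennreal (f (?x k \<omega>) - ?m) + ennreal ?s \<partial>M)"
    using contr le L(1) by (intro nn_integral_cong) (simp add: ennreal_plus ennreal_mult)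
  also have "\<dots> = ennreal ?c * (\<integral>\<^sup>+\<omega>. ennreal (f (?x k \<omega>) - ?m) \<partial>M) + ennreal ?s"
    by (simp add: nn_integral_add nn_integral_cmult emeasure_space_1)
  also have "\<dots> \<le> ennreal ?c * ennreal (?c ^ k * (f x0 - ?m) + L * \<gamma> * \<sigma>\<^sup>2 / \<mu>) + ennreal ?s"
    by (intro add_right_mono mult_left_mono Suc.IH) auto
  also have "\<dots> = ennreal (?c * (?c ^ k * (f x0 - ?m) + L * \<gamma> * \<sigma>\<^sup>2 / \<mu>) + ?s)"
    using contr le[of x0] L(1) PL(1) \<gamma>(1) by (simp add: ennreal_plus ennreal_mult)
  \<comment> \<open>The noise level \<open>L * \<gamma> * \<sigma>\<^sup>2 / \<mu>\<close> is the
    fixed point of \<open>t \<mapsto> ?c * t + ?s\<close>, so the induction reproduces it without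
    summing a geometric series.\<close>
  also have "?c * (?c ^ k * (f x0 - ?m) + L * \<gamma> * \<sigma>\<^sup>2 / \<mu>) + ?s
      = ?c ^ Suc k * (f x0 - ?m) + L * \<gamma> * \<sigma>\<^sup>2 / \<mu>"
    using PL(1) by (simp add: field_simps power2_eq_square)
  finally show ?case .
qed

text \<open>If \<open>\<gamma> * \<mu> \<le> 1\<close>, the finite nonnegative integral yields
  integrability and transfers to the Bochner integral; otherwise the gap vanishes identically. The
  dichotomy is exported because the iteration count needs the same case split.\<close>

lemma sgd_expectation_bound:
  fixes F :: "'n::finite \<Rightarrow> 'a::euclidean_space \<Rightarrow> real" and x0 :: 'a
  defines "f \<equiv> mean_fun F"
  assumes diff: "\<And>i x. F i differentiable (at x)"
    and ne: "minimizers f \<noteq> {}"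
    and v: "sampling_vector N v"
    and iid: "iid_copies N v M V"
    and noise: "gradient_noise F N v = ennreal (\<sigma>\<^sup>2)"
    and L: "L > 0" "L_smooth L f"
    and PL: "\<mu> > 0" "PL \<mu> f"
    and ER: "\<rho> \<ge> 0" "ER \<rho> F N v"
    and \<gamma>: "0 < \<gamma>" "\<gamma> \<le> 1 / (1 + 2 * \<rho> / \<mu>) * (1 / L)"
  defines "r \<equiv> \<lambda>k \<omega>. f (sgd F (\<lambda>_. \<gamma>) V x0 k \<omega>) - min_value f"
  shows "integrable M (r k)"
    and "integral\<^sup>L M (r k) \<le> (1 - \<gamma> * \<mu>) ^ k * (f x0 - min_value f) + L * \<gamma> * \<sigma>\<^sup>2 / \<mu>"
    and "\<gamma> * \<mu> \<le> 1 \<or> (\<forall>x. f x = min_value f)"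
proof -
  \<comment> \<open>The factor \<open>1 + 2 * \<rho> / \<mu>\<close> is at least 1.\<close>
  have "\<gamma> \<le> 1 * (1 / L)"
    using L(1) PL(1) ER(1) by (intro order_trans[OF \<gamma>(2)] mult_right_mono) (auto simp: add_pos_nonneg)
  then have "\<gamma> * L \<le> 1" using L(1) by (simp add: field_simps)
  then show contr: "\<gamma> * \<mu> \<le> 1 \<or> (\<forall>x. f x = min_value f)"
    using \<gamma>(1) by (intro PL_L_smooth_contraction[OF ne L PL]) auto
  have "integrable M (r k) \<and>
    integral\<^sup>L M (r k) \<le> (1 - \<gamma> * \<mu>) ^ k * (f x0 - min_value f) + L * \<gamma> * \<sigma>\<^sup>2 / \<mu>"
    using contr
  proof
    assume *: "\<gamma> * \<mu> \<le> 1"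
    have nn: "(\<integral>\<^sup>+\<omega>. ennreal (r k \<omega>) \<partial>M)
        \<le> ennreal ((1 - \<gamma> * \<mu>) ^ k * (f x0 - min_value f) + L * \<gamma> * \<sigma>\<^sup>2 / \<mu>)" (is "_ \<le> ennreal ?b")
      unfolding r_def f_def
      by (rule sgd_nn_integral_bound[OF diff ne[unfolded f_def] v iid noise
            L[unfolded f_def] PL[unfolded f_def] ER \<gamma> *])
    interpret prob_space M using iid by (simp add: iid_copies_def)
    have [measurable]: "V j \<in> borel_measurable M" for j
      using iid by (simp add: iid_copies_def indep_vars_def)
    have [measurable]: "sgd F (\<lambda>_. \<gamma>) V x0 k \<in> borel_measurable M"
      by (intro borel_measurable_sgd diff) measurable
    have [measurable]: "f \<in> borel_measurable borel"
      unfolding f_def by (rule borel_measurable_mean_fun) (rule diff)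
    have r_nonneg: "0 \<le> r k \<omega>" for \<omega> by (simp add: r_def min_value_le[OF ne])
    have int: "integrable M (r k)"
    proof (rule integrableI_nonneg)
      show "r k \<in> borel_measurable M" unfolding r_def by measurable
    qed (use nn r_nonneg in \<open>auto intro: le_less_trans\<close>)
    \<comment> \<open>Nonnegativity of \<open>?b\<close> permits the return from
      \<open>ennreal\<close> to the reals.\<close>
    have "0 \<le> ?b" using * min_value_le[OF ne, of x0] L(1) PL(1) \<gamma>(1) by simp
    then have "integral\<^sup>L M (r k) \<le> ?b"
      using nn int r_nonneg by (simp add: nn_integral_eq_integral)
    with int show ?thesis ..
  next
    assume "\<forall>x. f x = min_value f"
    then have "r k = (\<lambda>_. 0)" "f x0 - min_value f = 0" by (auto simp: r_def)
    then show ?thesis using L(1) PL(1) \<gamma>(1) by simp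
  qed
  then show "integrable M (r k)"
    and "integral\<^sup>L M (r k) \<le> (1 - \<gamma> * \<mu>) ^ k * (f x0 - min_value f) + L * \<gamma> * \<sigma>\<^sup>2 / \<mu>"
    by auto
qed

section \<open>Step size and iteration count\<close>

lemma power_one_minus_le:
  fixes a \<Delta> \<epsilon> :: real
  assumes a: "0 < a" "a \<le> 1" and "0 \<le> \<Delta>" "0 < \<epsilon>"
    and k: "real k \<ge> 1 / a * ln (\<Delta> / \<epsilon>)"
  shows "(1 - a) ^ k * \<Delta> \<le> \<epsilon>"
proof (cases "\<Delta> = 0")
  case False
  with assms have \<Delta>: "0 < \<Delta>" by simp
  \<comment> \<open>\<open>1 - a \<le> exp (- a)\<close>, and \<open>a \<le> 1\<close> keeps the
    base nonnegative, so the inequality survives the power.\<close>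
  have "(1 - a) ^ k \<le> exp (- a) ^ k"
    using a exp_ge_add_one_self[of "- a"] by (intro power_mono) auto
  also have "\<dots> = exp (- (a * real k))" by (simp flip: exp_of_nat_mult add: mult.commute)
  also have "\<dots> \<le> exp (- ln (\<Delta> / \<epsilon>))"
    using k a by (simp add: field_simps)
  also have "\<dots> = \<epsilon> / \<Delta>" using \<Delta> \<open>0 < \<epsilon>\<close> by (simp add: exp_minus)
  finally show ?thesis using \<Delta> by (simp add: field_simps)
qed (use assms in simp)

text \<open>All four claims come from the closed form \<open>\<gamma> = 1 / (L * max B A)\<close>: a
  minimum of reciprocals is the reciprocal of the maximum. For \<open>\<sigma> = 0\<close>,
  \<open>B = 0\<close> leaves the maximum at \<open>A\<close>, in agreement with the special case in
  \<open>step_size\<close>.\<close>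

lemma step_size_props:
  fixes L \<mu> \<rho> \<sigma> \<epsilon> :: real
  assumes "L > 0" "\<mu> > 0" "\<rho> \<ge> 0" "\<epsilon> > 0"
  defines "\<gamma> \<equiv> step_size L \<mu> \<rho> \<sigma> \<epsilon>"
  shows "0 < \<gamma>"
    and "\<gamma> \<le> 1 / (1 + 2 * \<rho> / \<mu>) * (1 / L)"
    and "L * \<gamma> * \<sigma>\<^sup>2 / \<mu> \<le> \<epsilon> / 2"
    and "L / \<mu> * max (2 * \<sigma>\<^sup>2 / (\<mu> * \<epsilon>)) (1 + 2 * \<rho> / \<mu>) = 1 / (\<gamma> * \<mu>)"
proof -
  define A where "A = 1 + 2 * \<rho> / \<mu>"
  have A: "0 < A" using assms by (simp add: A_def add_pos_nonneg)
  define B where "B = 2 * \<sigma>\<^sup>2 / (\<mu> * \<epsilon>)"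
  have B: "0 \<le> B" using assms by (simp add: B_def)
  have \<gamma>: "\<gamma> = 1 / (L * max B A)"
  proof (cases "\<sigma> = 0")
    case False
    then have "\<mu> * \<epsilon> / (2 * \<sigma>\<^sup>2) = 1 / B" "0 < B" using assms by (auto simp: B_def)
    then have "\<gamma> = 1 / L * min (1 / B) (1 / A)"
      using False by (simp add: \<gamma>_def step_size_def A_def)
    also have "min (1 / B) (1 / A) = 1 / max B A"
      using \<open>0 < B\<close> A by (auto simp: min_def max_def field_simps)
    finally show ?thesis by simp
  qed (use A in \<open>simp add: \<gamma>_def step_size_def B_def flip: A_def\<close>)
  have m: "0 < max B A" using A by simp
  show "0 < \<gamma>" using m assms(1) by (simp add: \<gamma>)
  show "\<gamma> \<le> 1 / (1 + 2 * \<rho> / \<mu>) * (1 / L)"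
    unfolding A_def[symmetric] \<gamma> using A assms(1) by (simp add: frac_le)
  \<comment> \<open>\<open>\<sigma>\<^sup>2 / \<mu>\<close> equals
    \<open>B * (\<epsilon> / 2)\<close>, and \<open>B / max B A\<close> is at most 1.\<close>
  have "L * \<gamma> * \<sigma>\<^sup>2 / \<mu> = B / max B A * (\<epsilon> / 2)"
    using assms(1-4) m by (simp add: \<gamma> B_def field_simps)
  also have "\<dots> \<le> 1 * (\<epsilon> / 2)"
    using m assms(4) by (intro mult_right_mono) auto
  finally show "L * \<gamma> * \<sigma>\<^sup>2 / \<mu> \<le> \<epsilon> / 2" by simp
  show "L / \<mu> * max (2 * \<sigma>\<^sup>2 / (\<mu> * \<epsilon>)) (1 + 2 * \<rho> / \<mu>) = 1 / (\<gamma> * \<mu>)"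
    unfolding A_def[symmetric] B_def[symmetric] \<gamma> by simp
qed

theorem theorem4p6:
  fixes F :: "'n::finite \<Rightarrow> real ^ 'd::finite \<Rightarrow> real"
    and N :: "'b measure" and v :: "'b \<Rightarrow> real ^ 'n"
    and M :: "'w measure" and V :: "nat \<Rightarrow> 'w \<Rightarrow> real ^ 'n"
    and x0 :: "real ^ 'd" and f :: "real ^ 'd \<Rightarrow> real"
    and L \<mu> \<rho> \<sigma> :: real
  assumes "\<And>i x. F i differentiable (at x)"
    and f: "f = mean_fun F"
    and "minimizers f \<noteq> {}"
    and "sampling_vector N v"
    and "iid_copies N v M V"
    and "\<sigma> \<ge> 0" and "gradient_noise F N v = ennreal (\<sigma>\<^sup>2)"
    and "L > 0" and "L_smooth L f"
    and "\<mu> > 0" and "PL \<mu> f"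
    and "\<rho> \<ge> 0" and "ER \<rho> F N v"
  shows
    "(\<forall>\<gamma>. 0 < \<gamma> \<and> \<gamma> \<le> 1 / (1 + 2 * \<rho> / \<mu>) * (1 / L) \<longrightarrow>
       (\<forall>k. integrable M (\<lambda>\<omega>. f (sgd F (\<lambda>_. \<gamma>) V x0 k \<omega>) - min_value f) \<and>
            (\<integral>\<omega>. f (sgd F (\<lambda>_. \<gamma>) V x0 k \<omega>) - min_value f \<partial>M)
              \<le> (1 - \<gamma> * \<mu>) ^ k * (f x0 - min_value f) + L * \<gamma> * \<sigma>\<^sup>2 / \<mu>)) \<and>
     (\<forall>\<epsilon>>0. \<forall>\<gamma>. \<gamma> = step_size L \<mu> \<rho> \<sigma> \<epsilon> \<longrightarrow>
       (\<forall>k. real k \<ge> L / \<mu> * max (2 * \<sigma>\<^sup>2 / (\<mu> * \<epsilon>)) (1 + 2 * \<rho> / \<mu>)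
                       * ln (2 * (f x0 - min_value f) / \<epsilon>) \<longrightarrow>
            integrable M (\<lambda>\<omega>. f (sgd F (\<lambda>_. \<gamma>) V x0 k \<omega>) - min_value f) \<and>
            (\<integral>\<omega>. f (sgd F (\<lambda>_. \<gamma>) V x0 k \<omega>) - min_value f \<partial>M) \<le> \<epsilon>))"
proof (intro conjI allI impI)
  note sgd = sgd_expectation_bound[OF assms(1) assms(3)[unfolded f] assms(4,5,7,8)
      assms(9)[unfolded f] assms(10) assms(11)[unfolded f] assms(12,13), folded f]
  {
    fix \<gamma> k
    assume "0 < \<gamma> \<and> \<gamma> \<le> 1 / (1 + 2 * \<rho> / \<mu>) * (1 / L)"
    then show "integrable M (\<lambda>\<omega>. f (sgd F (\<lambda>_. \<gamma>) V x0 k \<omega>) - min_value f)"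
      and "(\<integral>\<omega>. f (sgd F (\<lambda>_. \<gamma>) V x0 k \<omega>) - min_value f \<partial>M)
        \<le> (1 - \<gamma> * \<mu>) ^ k * (f x0 - min_value f) + L * \<gamma> * \<sigma>\<^sup>2 / \<mu>"
      using sgd(1,2) by blast+
  next
    fix \<epsilon> \<gamma> :: real and k
    assume "\<epsilon> > 0" and \<gamma>_eq: "\<gamma> = step_size L \<mu> \<rho> \<sigma> \<epsilon>"
      and k: "real k \<ge> L / \<mu> * max (2 * \<sigma>\<^sup>2 / (\<mu> * \<epsilon>)) (1 + 2 * \<rho> / \<mu>)
                       * ln (2 * (f x0 - min_value f) / \<epsilon>)"
    note \<gamma> = step_size_props[OF assms(8,10,12) \<open>\<epsilon> > 0\<close>, of \<sigma>, folded \<gamma>_eq]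
    show "integrable M (\<lambda>\<omega>. f (sgd F (\<lambda>_. \<gamma>) V x0 k \<omega>) - min_value f)"
      using sgd(1)[OF \<gamma>(1,2)] .
    \<comment> \<open>The error budget is halved between the initial gap and the noise. By
      \<open>\<gamma>(4)\<close>, the condition on \<open>k\<close> is the one in
      \<open>power_one_minus_le\<close> for \<open>a = \<gamma> * \<mu>\<close> and target
      \<open>\<epsilon> / 2\<close>. If \<open>f\<close> is constant, the initial gap is 0.\<close>
    have "(1 - \<gamma> * \<mu>) ^ k * (f x0 - min_value f) \<le> \<epsilon> / 2"
      using sgd(3)[OF \<gamma>(1,2)]
    proof
      assume "\<gamma> * \<mu> \<le> 1"
      then show ?thesis
        using k \<gamma>(1) assms(10) \<open>\<epsilon> > 0\<close> min_value_le[OF assms(3), of x0] unfolding \<gamma>(4)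
        by (intro power_one_minus_le) (auto simp: mult.commute)
    qed (use \<open>\<epsilon> > 0\<close> in simp)
    with sgd(2)[OF \<gamma>(1,2), of x0 k] \<gamma>(3)
    show "(\<integral>\<omega>. f (sgd F (\<lambda>_. \<gamma>) V x0 k \<omega>) - min_value f \<partial>M) \<le> \<epsilon>"
      by linarith
  }
qed

end
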